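(* Consider the $H_\infty$ problem with control, state and terminal constraints and terminal cost $V_f$ and terminal set $X_f$ as in the context, and the receding horizon controller $u=\kappa_N(x)$. Then: (a) the controlled system $x^+=f(x,\kappa_N(x),w)$ has the finite $\ell_2$ gain property: for every initial state $x$ in the interior of $X_N$ and every $\ell_2$ disturbance sequence $\mathbf{w}=\{w(0),w(1),\dots\}$ with $w(i)\in W$ for all $i$, $$\frac12\sum_{i=0}^\infty|y(i)|^2\le\frac{\gamma^2}{2}\sum_{i=0}^\infty|w(i)|^2+V_N^0(x),$$ where $x(i)$ is the solution of the controlled system with $x(0)=x$, and $|y(i)|^2=x(i)'Qx(i)+u(i)'Ru(i)$ with $u(i)=\kappa_N(x(i))$; (b) if the disturbance is identically zero, the origin is exponentially stable with a region of attraction $X_N$.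
   Context: System: $x^+=f(x,u,w)=Ax+Bu+Gw$, $x\in\mathbb{R}^n$, $u\in\mathbb{R}^m$, $w\in\mathbb{R}^p$; constraints $x\in X$, $u\in U$, $w\in W$, where $X,U,W$ are polytopes containing the origin in their interiors. Stage cost $\ell(x,u,w)=\frac12x'Qx+\frac12u'Ru-\frac{\gamma^2}2|w|^2=\frac12|y|^2-\frac{\gamma^2}{2}|w|^2$, $Q,R$ positive definite, where $y=Hz$, $z=(x,u)$, for a suitable matrix $H$. $f(x,u,W)=\{f(x,u,w)\mid w\in W\}$. Terminal cost and set: $(A,B)$ is stabilizable, and $(C,A,B)$ has no zeros on the unit circle, where $Q=C'C$. The number $\gamma$ is large enough that the $H_\infty$ algebraic Riccati equation of the unconstrained infinite horizon linear $H_\infty$ problem has a positive definite solution $P_f$, with associated optimal control and disturbance laws $u=K_ux$, $w=K_wx$ (so that, with $V_f(x)=\frac12x'P_fx$, $V_f(x)=\min_u\max_w\{\ell(x,u,w)+V_f(f(x,u,w))\}$ over unconstrained $u,w$, attained at $K_ux,K_wx$), and $A+BK_u$ and $A+BK_u+GK_w$ are stable. $X_f$ is a polytope containing the origin in its interior, disturbance invariant for $x^+=(A+BK_u)x+Gw$ (i.e. $f(x,K_ux,W)\subseteq X_f$ for all $x\in X_f$), with $X_f\subseteq X$, $K_uX_f\subseteq U$, $K_wX_f\subseteq W$; $W$ is assumed small enough and $\gamma$ large enough for such an $X_f$ to exist. Recursion (horizon $N\ge1$): $V_0^0=V_f$, $X_0=X_f$ and, for $j=1,\dots,N$, $$V_j^0(x)=\min_{u\in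 U}\max_{w\in W}\{\ell(x,u,w)+V_{j-1}^0(f(x,u,w))\mid f(x,u,W)\subseteq X_{j-1}\},$$ $\kappa_j(x)$ is the corresponding minimizing $u$, and $X_j=X\cap\{x\mid\exists u\in U\text{ such that }f(x,u,W)\subseteq X_{j-1}\}$. *)

theory Defs
  imports "HOL-Analysis.Analysis"
begin

section \<open>Matrices\<close>

definition pos_def :: "real^'n^'n \<Rightarrow> bool" where
  "pos_def M \<longleftrightarrow> transpose M = M \<and> (\<forall>x. x \<noteq> 0 \<longrightarrow> 0 < x \<bullet> (M *v x))"

text \<open>On vectors of scalars \<open>stack x u\<close> is the vector \<open>(x, u)\<close>. A matrix is the vector of its
  rows, so on matrices \<open>stack M N\<close> is \<open>M\<close> placed on top of \<open>N\<close>.\<close>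

definition stack :: "'a^'m \<Rightarrow> 'a^'p \<Rightarrow> 'a^('m + 'p)" where
  "stack x y = (\<chi> i. case i of Inl a \<Rightarrow> x $ a | Inr b \<Rightarrow> y $ b)"

definition hcat :: "'a^'m^'n \<Rightarrow> 'a^'p^'n \<Rightarrow> 'a^('m + 'p)^'n" where
  "hcat M N = (\<chi> i. stack (M $ i) (N $ i))"

definition block_matrix ::
  "'a^'m^'n \<Rightarrow> 'a^'p^'n \<Rightarrow> 'a^'m^'k \<Rightarrow> 'a^'p^'k \<Rightarrow> 'a^('m + 'p)^('n + 'k)" where
  "block_matrix M11 M12 M21 M22 = stack (hcat M11 M12) (hcat M21 M22)"

abbreviation complex_matrix :: "real^'m^'n \<Rightarrow> complex^'m^'n" where
  "complex_matrix M \<equiv> map_matrix complex_of_real M"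


section \<open>Discrete-time linear systems\<close>

definition schur_stable :: "real^'n^'n \<Rightarrow> bool" where
  "schur_stable M \<longleftrightarrow>
     (\<forall>(z::complex) v. v \<noteq> 0 \<and> complex_matrix M *v v = z *s v \<longrightarrow> cmod z < 1)"

definition stabilizable :: "real^'n^'n \<Rightarrow> real^'m^'n \<Rightarrow> bool" where
  "stabilizable A B \<longleftrightarrow> (\<exists>K. schur_stable (A + B ** K))"

definition rosenbrock_pencil ::
  "real^'n^'q \<Rightarrow> real^'n^'n \<Rightarrow> real^'m^'n \<Rightarrow> complex \<Rightarrow> complex^('n + 'm)^('n + 'q)" where
  "rosenbrock_pencil C A B z =
     block_matrix (complex_matrix A - mat z) (complex_matrix B) (complex_matrix C) 0"

text \<open>An invariant zero is a point at which the pencil drops below its normal rank, i.e. below the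
  maximal rank it attains.\<close>

definition invariant_zero ::
  "real^'n^'q \<Rightarrow> real^'n^'n \<Rightarrow> real^'m^'n \<Rightarrow> complex \<Rightarrow> bool" where
  "invariant_zero C A B z \<longleftrightarrow>
     (\<exists>s. rank (rosenbrock_pencil C A B z) < rank (rosenbrock_pencil C A B s))"


section \<open>The unconstrained infinite horizon problem\<close>

definition riccati_weight ::
  "real^'m^'n \<Rightarrow> real^'p^'n \<Rightarrow> real^'m^'m \<Rightarrow> real \<Rightarrow> real^'n^'n \<Rightarrow> real^('m + 'p)^('m + 'p)" where
  "riccati_weight B G R \<gamma> P =
     transpose (hcat B G) ** P ** hcat B G + block_matrix R 0 0 (mat (- (\<gamma>\<^sup>2)))"

definition hinf_riccati ::
  "real^'n^'n \<Rightarrow> real^'m^'n \<Rightarrow> real^'p^'n \<Rightarrow> real^'n^'n \<Rightarrow> real^'m^'m \<Rightarrow> real \<Rightarrow> real^'n^'n \<Rightarrow> bool" where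
  "hinf_riccati A B G Q R \<gamma> P \<longleftrightarrow>
     invertible (riccati_weight B G R \<gamma> P) \<and>
     P = Q + transpose A ** P ** A
         - transpose A ** P ** hcat B G ** matrix_inv (riccati_weight B G R \<gamma> P)
             ** transpose (hcat B G) ** P ** A"

text \<open>The stationary point in \<open>(u, w)\<close> of the quadratic form associated with \<open>P\<close> is
  \<open>(Ku x, Kw x)\<close>.\<close>

definition hinf_gains ::
  "real^'n^'n \<Rightarrow> real^'m^'n \<Rightarrow> real^'p^'n \<Rightarrow> real^'m^'m \<Rightarrow> real \<Rightarrow> real^'n^'n
     \<Rightarrow> real^'n^'m \<Rightarrow> real^'n^'p \<Rightarrow> bool" where
  "hinf_gains A B G R \<gamma> P Ku Kw \<longleftrightarrow>
     stack Ku Kw = - (matrix_inv (riccati_weight B G R \<gamma> P) ** transpose (hcat B G) ** P ** A)"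

text \<open>\<open>c = min\<^sub>u max\<^sub>w J u w\<close>, attained at \<open>(u0, w0)\<close>. The supremum is taken in the extended reals
  because the unconstrained inner maximum may be infinite for some \<open>u\<close>.\<close>

definition min_max_attained ::
  "('u \<Rightarrow> 'w \<Rightarrow> real) \<Rightarrow> 'u \<Rightarrow> 'w \<Rightarrow> real \<Rightarrow> bool" where
  "min_max_attained J u0 w0 c \<longleftrightarrow>
     J u0 w0 = c \<and> (\<forall>w. J u0 w \<le> c) \<and> (\<forall>u. ereal c \<le> (SUP w. ereal (J u w)))"


section \<open>The constrained recursion\<close>

primrec feas_set ::
  "('x \<Rightarrow> 'u \<Rightarrow> 'w \<Rightarrow> 'x) \<Rightarrow> 'x set \<Rightarrow> 'u set \<Rightarrow> 'w set \<Rightarrow> 'x set \<Rightarrow> nat \<Rightarrow> 'x set" where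
  "feas_set f X U W Xf 0 = Xf"
| "feas_set f X U W Xf (Suc j) = X \<inter> {x. \<exists>u\<in>U. f x u ` W \<subseteq> feas_set f X U W Xf j}"

definition admissible_inputs ::
  "('x \<Rightarrow> 'u \<Rightarrow> 'w \<Rightarrow> 'x) \<Rightarrow> 'u set \<Rightarrow> 'w set \<Rightarrow> 'x set \<Rightarrow> 'x \<Rightarrow> 'u set" where
  "admissible_inputs f U W S x = {u \<in> U. f x u ` W \<subseteq> S}"

definition worst_cost ::
  "('x \<Rightarrow> 'u \<Rightarrow> 'w \<Rightarrow> 'x) \<Rightarrow> ('x \<Rightarrow> 'u \<Rightarrow> 'w \<Rightarrow> real) \<Rightarrow> 'w set \<Rightarrow> ('x \<Rightarrow> real) \<Rightarrow> 'x \<Rightarrow> 'u \<Rightarrow> real" where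
  "worst_cost f l W V x u = (SUP w\<in>W. l x u w + V (f x u w))"

text \<open>Real-valued \<open>INF\<close> and \<open>SUP\<close> render the minimum and maximum. \<open>opt_cost \<dots> j\<close> is meaningful on
  \<open>feas_set \<dots> j\<close> only; values elsewhere never enter the recursion on the feasible sets.\<close>

primrec opt_cost ::
  "('x \<Rightarrow> 'u \<Rightarrow> 'w \<Rightarrow> 'x) \<Rightarrow> ('x \<Rightarrow> 'u \<Rightarrow> 'w \<Rightarrow> real) \<Rightarrow> 'x set \<Rightarrow> 'u set \<Rightarrow> 'w set
     \<Rightarrow> ('x \<Rightarrow> real) \<Rightarrow> 'x set \<Rightarrow> nat \<Rightarrow> 'x \<Rightarrow> real" where
  "opt_cost f l X U W Vf Xf 0 = Vf"
| "opt_cost f l X U W Vf Xf (Suc j) =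
     (\<lambda>x. INF u\<in>admissible_inputs f U W (feas_set f X U W Xf j) x.
        worst_cost f l W (opt_cost f l X U W Vf Xf j) x u)"

text \<open>For \<open>j \<ge> 1\<close>, the minimizer in the definition of \<open>opt_cost \<dots> j\<close>.\<close>

definition opt_law ::
  "('x \<Rightarrow> 'u \<Rightarrow> 'w \<Rightarrow> 'x) \<Rightarrow> ('x \<Rightarrow> 'u \<Rightarrow> 'w \<Rightarrow> real) \<Rightarrow> 'x set \<Rightarrow> 'u set \<Rightarrow> 'w set
     \<Rightarrow> ('x \<Rightarrow> real) \<Rightarrow> 'x set \<Rightarrow> nat \<Rightarrow> 'x \<Rightarrow> 'u" where
  "opt_law f l X U W Vf Xf j x =
     arg_min_on (worst_cost f l W (opt_cost f l X U W Vf Xf (j - 1)) x)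
       (admissible_inputs f U W (feas_set f X U W Xf (j - 1)) x)"


section \<open>Closed loop\<close>

primrec closed_loop ::
  "('x \<Rightarrow> 'u \<Rightarrow> 'w \<Rightarrow> 'x) \<Rightarrow> ('x \<Rightarrow> 'u) \<Rightarrow> (nat \<Rightarrow> 'w) \<Rightarrow> 'x \<Rightarrow> nat \<Rightarrow> 'x" where
  "closed_loop f \<kappa> w x 0 = x"
| "closed_loop f \<kappa> w x (Suc i) =
     f (closed_loop f \<kappa> w x i) (\<kappa> (closed_loop f \<kappa> w x i)) (w i)"

definition finite_l2_gain ::
  "('x \<Rightarrow> 'u \<Rightarrow> 'w::real_normed_vector \<Rightarrow> 'x) \<Rightarrow> ('x \<Rightarrow> 'u) \<Rightarrow> ('x \<Rightarrow> 'u \<Rightarrow> 'y::real_normed_vector)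
     \<Rightarrow> 'w set \<Rightarrow> real \<Rightarrow> ('x \<Rightarrow> real) \<Rightarrow> 'x set \<Rightarrow> bool" where
  "finite_l2_gain f \<kappa> h W \<gamma> V S \<longleftrightarrow>
     (\<forall>x\<in>S. \<forall>w. (\<forall>i. w i \<in> W) \<and> summable (\<lambda>i. (norm (w i))\<^sup>2) \<longrightarrow>
        (let y = (\<lambda>i. h (closed_loop f \<kappa> w x i) (\<kappa> (closed_loop f \<kappa> w x i)))
         in summable (\<lambda>i. (norm (y i))\<^sup>2) \<and>
            1 / 2 * (\<Sum>i. (norm (y i))\<^sup>2) \<le> \<gamma>\<^sup>2 / 2 * (\<Sum>i. (norm (w i))\<^sup>2) + V x))"

definition exp_stable_region :: "('x::real_normed_vector \<Rightarrow> 'x) \<Rightarrow> 'x set \<Rightarrow> bool" where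
  "exp_stable_region g S \<longleftrightarrow>
     0 \<in> interior S \<and> g ` S \<subseteq> S \<and>
     (\<exists>c \<rho>. 0 < c \<and> 0 < \<rho> \<and> \<rho> < 1 \<and>
        (\<forall>x\<in>S. \<forall>i. norm ((g ^^ i) x) \<le> c * \<rho> ^ i * norm x))"

end

theory Submission
  imports Defs
begin

text \<open>
  Write \<open>V\<^sub>j\<close> for the value functions and \<open>X\<^sub>j\<close> for their domains. Everything follows from two facts
  about them.

  \<^item> The minimum in the recursion is attained, so that \<open>\<kappa>\<^sub>N\<close> really is a minimizer and
    \<open>V\<^sub>N x \<ge> l x (\<kappa>\<^sub>N x) w + V\<^bsub>N-1\<^esub> (f x (\<kappa>\<^sub>N x) w)\<close> for every \<open>w \<in> W\<close>.
    This rests on lower semicontinuity of \<open>V\<^sub>j\<close>, that is, on a closed epigraph, and closed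
    epigraphs pass through the recursion: taking the maximum over \<open>w\<close> intersects closed sets, and
    minimizing over \<open>u\<close> projects a closed set along the compact set \<open>U\<close>. So one step of dynamic
    programming is an operator on epigraphs (\<open>epigraph_step\<close>) that preserves closedness
    (\<open>closed_epigraph_step\<close>), and \<open>minimizer_exists\<close> follows.

  \<^item> \<open>X\<^sub>j \<subseteq> X\<^bsub>j+1\<^esub>\<close> and \<open>V\<^bsub>j+1\<^esub> \<le> V\<^sub>j\<close> on \<open>X\<^sub>j\<close>, in other words the epigraphs grow
    with \<open>j\<close> (\<open>epigraph_cost_mono\<close>). The operator on epigraphs is monotone, so it suffices to
    compare the first two, and there \<open>u = Ku x\<close> does it: it keeps the state in \<open>Xf\<close>, and no
    disturbance, constrained or not, makes the stage cost plus \<open>Vf\<close> at the successor exceed \<open>Vf x\<close>.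

  Together they give the dissipation inequality
  \<open>V\<^sub>N (f x (\<kappa>\<^sub>N x) w) + l x (\<kappa>\<^sub>N x) w \<le> V\<^sub>N x\<close> on \<open>X\<^sub>N\<close>. Its sum along a trajectory is the gain bound
  (\<open>finite_l2_gain_if_dissipative\<close>), since \<open>V\<^sub>N \<ge> 0\<close>. For \<open>w = 0\<close> it says that \<open>V\<^sub>N\<close> decreases by at least \<open>1 / 2 * (x \<bullet> (Q *v x))\<close>.
  That quantity also bounds \<open>V\<^sub>N x\<close> from below, and \<open>V\<^sub>N\<close> is at most a multiple of
  \<open>(norm x)\<^sup>2\<close>, near the origin because \<open>V\<^sub>N \<le> Vf\<close> on \<open>Xf\<close>, elsewhere because \<open>V\<^sub>N\<close> is bounded. Hence \<open>V\<^sub>N\<close>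
  decays geometrically (\<open>exp_stable_region_if_quadratic_lyapunov\<close>).
\<close>

section \<open>Quadratic bounds\<close>

lemma continuous_on_quadratic_form:
  fixes M :: "real^'n^'n"
  shows "continuous_on T (\<lambda>x. x \<bullet> (M *v x))"
  by (intro continuous_intros)

text \<open>On the unit sphere the form attains a positive minimum; homogeneity does the rest.\<close>

lemma pos_def_quadratic_lower_bound:
  fixes M :: "real^'n^'n"
  assumes "pos_def M"
  obtains a where "0 < a" "\<And>x. a * (norm x)\<^sup>2 \<le> x \<bullet> (M *v x)"
proof -
  obtain x0 :: "real^'n" where x0: "x0 \<in> sphere 0 1"
    and le: "\<And>x. x \<in> sphere 0 1 \<Longrightarrow> x0 \<bullet> (M *v x0) \<le> x \<bullet> (M *v x)"
    using continuous_attains_inf[OF compact_sphere _ continuous_on_quadratic_form,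
        of "0 :: real^'n" 1 M] by auto
  have "x0 \<noteq> 0" using x0 by auto
  then have "0 < x0 \<bullet> (M *v x0)" using assms by (simp add: pos_def_def)
  moreover have "x0 \<bullet> (M *v x0) * (norm x)\<^sup>2 \<le> x \<bullet> (M *v x)" for x
  proof (cases "x = 0")
    case False
    define y where "y = (1 / norm x) *\<^sub>R x"
    have x: "x = norm x *\<^sub>R y" using False by (simp add: y_def)
    have "y \<in> sphere 0 1" using False by (simp add: y_def)
    then have "x0 \<bullet> (M *v x0) * (norm x)\<^sup>2 \<le> (y \<bullet> (M *v y)) * (norm x)\<^sup>2"
      by (intro mult_right_mono le) auto
    also have "\<dots> = (norm x *\<^sub>R y) \<bullet> (M *v (norm x *\<^sub>R y))"
      by (simp add: matrix_vector_mult_scaleR power2_eq_square)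
    finally show ?thesis using x by simp
  qed simp
  ultimately show thesis by (rule that)
qed

lemma quadratic_form_upper_bound:
  fixes M :: "real^'n^'n"
  obtains b where "\<And>x. x \<bullet> (M *v x) \<le> b * (norm x)\<^sup>2"
proof -
  obtain b where b: "\<And>x. norm (M *v x) \<le> b * norm x"
    using linear_bounded[OF matrix_vector_mul_linear] by blast
  have "x \<bullet> (M *v x) \<le> b * (norm x)\<^sup>2" for x
  proof -
    have "x \<bullet> (M *v x) \<le> norm x * norm (M *v x)" by (rule norm_cauchy_schwarz)
    also have "\<dots> \<le> norm x * (b * norm x)" by (intro mult_left_mono b) auto
    finally show ?thesis by (simp add: power2_eq_square ac_simps)
  qed
  then show thesis by (rule that)
qed

text \<open>Away from the origin \<open>(norm x)\<^sup>2\<close> is bounded below, so there a constant bound on \<open>V\<close> is a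
  quadratic one.\<close>

lemma quadratic_upper_bound_extend:
  fixes V :: "'a::real_normed_vector \<Rightarrow> real"
  assumes "0 \<in> interior T" and near: "\<And>x. x \<in> T \<Longrightarrow> V x \<le> b * (norm x)\<^sup>2"
    and "bdd_above (V ` S)"
  obtains b' where "\<And>x. x \<in> S \<Longrightarrow> V x \<le> b' * (norm x)\<^sup>2"
proof -
  obtain r where r: "0 < r" "ball 0 r \<subseteq> T" using assms(1) by (auto simp: mem_interior)
  obtain L where L: "\<And>x. x \<in> S \<Longrightarrow> V x \<le> L" using assms(3) by (auto simp: bdd_above_def)
  have "V x \<le> max b (\<bar>L\<bar> / r\<^sup>2) * (norm x)\<^sup>2" if "x \<in> S" for x
  proof (cases "norm x < r")
    case True
    then have "V x \<le> b * (norm x)\<^sup>2" using r by (intro near) auto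
    also have "\<dots> \<le> max b (\<bar>L\<bar> / r\<^sup>2) * (norm x)\<^sup>2" by (intro mult_right_mono) auto
    finally show ?thesis .
  next
    case False
    have "V x \<le> \<bar>L\<bar> / r\<^sup>2 * r\<^sup>2" using L[OF that] r by simp
    also have "\<dots> \<le> \<bar>L\<bar> / r\<^sup>2 * (norm x)\<^sup>2" using False r by (intro mult_left_mono power_mono) auto
    also have "\<dots> \<le> max b (\<bar>L\<bar> / r\<^sup>2) * (norm x)\<^sup>2" by (intro mult_right_mono) auto
    finally show ?thesis .
  qed
  then show thesis by (rule that)
qed


section \<open>Storage and Lyapunov functions\<close>

text \<open>Summed along a trajectory, the dissipation inequality telescopes, and what is left of the storage
  at the end is nonnegative.\<close>

lemma finite_l2_gain_if_dissipative:
  assumes nonneg: "\<And>x. x \<in> S \<Longrightarrow> 0 \<le> V x"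
    and invar: "\<And>x w. x \<in> S \<Longrightarrow> w \<in> W \<Longrightarrow> f x (\<kappa> x) w \<in> S"
    and dissip: "\<And>x w. x \<in> S \<Longrightarrow> w \<in> W \<Longrightarrow>
      V (f x (\<kappa> x) w) + 1 / 2 * (norm (h x (\<kappa> x)))\<^sup>2 \<le> V x + \<gamma>\<^sup>2 / 2 * (norm w)\<^sup>2"
  shows "finite_l2_gain f \<kappa> h W \<gamma> V S"
  unfolding finite_l2_gain_def Let_def
proof (intro ballI allI impI, elim conjE)
  fix x w
  assume "x \<in> S" and w: "\<forall>i. w i \<in> W" and sw: "summable (\<lambda>i. (norm (w i))\<^sup>2)"
  define \<xi> where "\<xi> = closed_loop f \<kappa> w x"
  define y where "y = (\<lambda>i. h (\<xi> i) (\<kappa> (\<xi> i)))"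
  have \<xi>_in: "\<xi> i \<in> S" for i
    by (induction i) (use \<open>x \<in> S\<close> invar w in \<open>auto simp: \<xi>_def\<close>)
  have telescoped: "V (\<xi> n) + 1 / 2 * (\<Sum>i<n. (norm (y i))\<^sup>2)
      \<le> V x + \<gamma>\<^sup>2 / 2 * (\<Sum>i<n. (norm (w i))\<^sup>2)" for n
  proof (induction n)
    case (Suc n)
    have "V (\<xi> (Suc n)) + 1 / 2 * (norm (y n))\<^sup>2 \<le> V (\<xi> n) + \<gamma>\<^sup>2 / 2 * (norm (w n))\<^sup>2"
      using dissip[OF \<xi>_in, of "w n" n] w by (simp add: y_def \<xi>_def)
    with Suc show ?case by (simp add: algebra_simps)
  qed (simp add: \<xi>_def)
  let ?c = "\<gamma>\<^sup>2 / 2 * (\<Sum>i. (norm (w i))\<^sup>2) + V x"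
  have partial: "(\<Sum>i<n. (norm (y i))\<^sup>2) \<le> 2 * ?c" for n
  proof -
    have "\<gamma>\<^sup>2 / 2 * (\<Sum>i<n. (norm (w i))\<^sup>2) \<le> \<gamma>\<^sup>2 / 2 * (\<Sum>i. (norm (w i))\<^sup>2)"
      by (intro mult_left_mono sum_le_suminf sw) auto
    then show ?thesis using telescoped[of n] nonneg[OF \<xi>_in, of n] by simp
  qed
  have "summable (\<lambda>i. (norm (y i))\<^sup>2)"
    using partial by (intro summableI_nonneg_bounded[where x = "2 * ?c"]) auto
  moreover from this have "(\<Sum>i. (norm (y i))\<^sup>2) \<le> 2 * ?c"
    using partial by (rule suminf_le_const)
  ultimately show "summable (\<lambda>i. (norm (h (closed_loop f \<kappa> w x i) (\<kappa> (closed_loop f \<kappa> w x i))))\<^sup>2) \<and>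
      1 / 2 * (\<Sum>i. (norm (h (closed_loop f \<kappa> w x i) (\<kappa> (closed_loop f \<kappa> w x i))))\<^sup>2) \<le> ?c"
    by (simp add: y_def \<xi>_def)
qed

text \<open>The decrease \<open>a * (norm x)\<^sup>2\<close> is at least the fraction \<open>a / b\<close> of \<open>V x\<close>, so \<open>V\<close> decays
  geometrically, and the two-sided quadratic bound turns this into a decay of the norm.\<close>

lemma exp_stable_region_if_quadratic_lyapunov:
  fixes V :: "'a::real_normed_vector \<Rightarrow> real"
  assumes "0 \<in> interior S" and invar: "g ` S \<subseteq> S" and "0 < a"
    and lower: "\<And>x. x \<in> S \<Longrightarrow> a * (norm x)\<^sup>2 \<le> V x"
    and upper: "\<And>x. x \<in> S \<Longrightarrow> V x \<le> b0 * (norm x)\<^sup>2"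
    and decrease: "\<And>x. x \<in> S \<Longrightarrow> V (g x) \<le> V x - a * (norm x)\<^sup>2"
  shows "exp_stable_region g S"
proof -
  \<comment> \<open>Enlarging the upper constant keeps the contraction factor \<open>1 - a / b\<close> strictly positive.\<close>
  define b where "b = max b0 (2 * a)"
  define q where "q = 1 - a / b"
  have b: "a < b" using \<open>0 < a\<close> by (auto simp: b_def)
  have q: "0 < q" "q < 1" using \<open>0 < a\<close> b by (auto simp: q_def)
  have upper': "V x \<le> b * (norm x)\<^sup>2" if "x \<in> S" for x
    using upper[OF that] mult_right_mono[of b0 b "(norm x)\<^sup>2"] by (simp add: b_def)
  have contract: "V (g x) \<le> q * V x" if "x \<in> S" for x
  proof -
    have "a / b * V x \<le> a / b * (b * (norm x)\<^sup>2)"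
      using \<open>0 < a\<close> b by (intro mult_left_mono upper' that) auto
    then show ?thesis using decrease[OF that] \<open>0 < a\<close> b by (simp add: q_def algebra_simps)
  qed
  have iterates: "(g ^^ i) x \<in> S \<and> V ((g ^^ i) x) \<le> q ^ i * V x" if "x \<in> S" for x i
  proof (induction i)
    case (Suc i)
    then have "V (g ((g ^^ i) x)) \<le> q * V ((g ^^ i) x)" using contract by blast
    also have "\<dots> \<le> q * (q ^ i * V x)" using Suc q by (intro mult_left_mono) auto
    finally show ?case using Suc invar by (auto simp: ac_simps)
  qed (use that in simp)
  have "norm ((g ^^ i) x) \<le> sqrt (b / a) * sqrt q ^ i * norm x" if "x \<in> S" for x i
  proof -
    have "a * (norm ((g ^^ i) x))\<^sup>2 \<le> V ((g ^^ i) x)" using iterates[OF that] lower by blast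
    also have "\<dots> \<le> q ^ i * V x" using iterates[OF that] by blast
    also have "\<dots> \<le> q ^ i * (b * (norm x)\<^sup>2)"
      using q by (intro mult_left_mono upper' that) auto
    finally have "(norm ((g ^^ i) x))\<^sup>2 \<le> b / a * q ^ i * (norm x)\<^sup>2"
      using \<open>0 < a\<close> by (simp add: field_simps)
    then have "sqrt ((norm ((g ^^ i) x))\<^sup>2) \<le> sqrt (b / a * q ^ i * (norm x)\<^sup>2)"
      by (rule real_sqrt_le_mono)
    then show ?thesis by (simp add: real_sqrt_mult real_sqrt_power del: times_divide_eq_left)
  qed
  moreover have "0 < sqrt (b / a)" "0 < sqrt q" "sqrt q < 1" using \<open>0 < a\<close> b q by auto
  ultimately show ?thesis using assms(1) invar unfolding exp_stable_region_def by blast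
qed


section \<open>Dynamic programming on epigraphs\<close>

text \<open>The last assumption is what the terminal ingredients contribute: from \<open>Xf\<close> there is
  an input that keeps the state in \<open>Xf\<close> and pays, in the worst case, no more than \<open>Vf\<close>.\<close>

locale minmax_problem =
  fixes f :: "'x::euclidean_space \<Rightarrow> 'u::euclidean_space \<Rightarrow> 'w::zero \<Rightarrow> 'x"
    and l :: "'x \<Rightarrow> 'u \<Rightarrow> 'w \<Rightarrow> real"
    and X :: "'x set" and U :: "'u set" and W :: "'w set"
    and Vf :: "'x \<Rightarrow> real" and Xf :: "'x set"
  assumes continuous_f: "\<And>w. w \<in> W \<Longrightarrow> continuous_on UNIV (\<lambda>(x, u). f x u w)"
    and continuous_l: "\<And>w. w \<in> W \<Longrightarrow> continuous_on UNIV (\<lambda>(x, u). l x u w)"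
    and stage_bounded: "\<exists>L. \<forall>x\<in>X. \<forall>u\<in>U. \<forall>w\<in>W. l x u w \<le> L"
    and stage_nonneg: "\<And>x u. 0 \<le> l x u 0"
    and closed_X: "closed X" and compact_U: "compact U" and zero_in_W: "0 \<in> W"
    and terminal_closed: "closed (epigraph Xf Vf)"
    and terminal_bounded: "bdd_above (Vf ` Xf)"
    and terminal_nonneg: "\<And>x. x \<in> Xf \<Longrightarrow> 0 \<le> Vf x"
    and terminal_subset: "Xf \<subseteq> X"
    and terminal_control: "\<And>x. x \<in> Xf \<Longrightarrow>
      \<exists>u\<in>U. \<forall>w\<in>W. f x u w \<in> Xf \<and> l x u w + Vf (f x u w) \<le> Vf x"
begin

abbreviation feas :: "nat \<Rightarrow> 'x set" where
  "feas \<equiv> feas_set f X U W Xf"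

abbreviation cost :: "nat \<Rightarrow> 'x \<Rightarrow> real" where
  "cost \<equiv> opt_cost f l X U W Vf Xf"

abbreviation law :: "nat \<Rightarrow> 'x \<Rightarrow> 'u" where
  "law \<equiv> opt_law f l X U W Vf Xf"

text \<open>The Bellman operator acting on epigraphs. Membership of the successor in the previous feasible set
  is part of the condition, because an epigraph remembers the domain of its function.\<close>

definition epigraph_step :: "('x \<times> real) set \<Rightarrow> ('x \<times> real) set" where
  "epigraph_step E = {(x, c). x \<in> X \<and> (\<exists>u\<in>U. \<forall>w\<in>W. (f x u w, c - l x u w) \<in> E)}"

lemma epigraph_step_mono: "E \<subseteq> E' \<Longrightarrow> epigraph_step E \<subseteq> epigraph_step E'"
  unfolding epigraph_step_def by blast

text \<open>The supremum over \<open>w\<close> becomes an intersection of closed sets, the infimum over \<open>u\<close> a projection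
  along a compact set.\<close>

lemma closed_epigraph_step:
  assumes "closed E"
  shows "closed (epigraph_step E)"
proof -
  define D where "D = (\<Inter>w\<in>W. (\<lambda>(u, x, c). (f x u w, c - l x u w)) -` E)"
  have "closed D"
    unfolding D_def
  proof (intro closed_INT ballI closed_vimage assms)
    fix w assume w: "w \<in> W"
    show "continuous_on UNIV (\<lambda>(u, x, c). (f x u w, c - l x u w))"
      unfolding case_prod_unfold
      by (intro continuous_intros
            continuous_on_compose2[OF continuous_f[OF w, unfolded case_prod_unfold],
              of _ "\<lambda>p. (fst (snd p), fst p)", simplified]
            continuous_on_compose2[OF continuous_l[OF w, unfolded case_prod_unfold],
              of _ "\<lambda>p. (fst (snd p), fst p)", simplified])
  qed
  then have "closed ((X \<times> UNIV) \<inter> {p. \<exists>u. u \<in> U \<and> (u, p) \<in> D})"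
    by (intro closed_Int closed_Times closed_X closed_UNIV closed_compact_projection compact_U)
  moreover have "(X \<times> UNIV) \<inter> {p. \<exists>u. u \<in> U \<and> (u, p) \<in> D} = epigraph_step E"
    by (auto simp: D_def epigraph_step_def)
  ultimately show ?thesis by simp
qed

text \<open>A real-valued supremum obeys its defining property only over a set that is bounded above, so
  boundedness of the value functions has to be carried through the recursion.\<close>

lemma worst_cost_le_iff:
  assumes "bdd_above (V ` S)" "x \<in> X" "u \<in> admissible_inputs f U W S x"
  shows "worst_cost f l W V x u \<le> c \<longleftrightarrow> (\<forall>w\<in>W. l x u w + V (f x u w) \<le> c)"
proof -
  obtain L where L: "\<And>x u w. x \<in> X \<Longrightarrow> u \<in> U \<Longrightarrow> w \<in> W \<Longrightarrow> l x u w \<le> L"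
    using stage_bounded by blast
  obtain M where M: "\<And>x. x \<in> S \<Longrightarrow> V x \<le> M" using assms(1) by (auto simp: bdd_above_def)
  have "l x u w + V (f x u w) \<le> L + M" if "w \<in> W" for w
    using assms(2,3) that by (intro add_mono L M) (auto simp: admissible_inputs_def)
  then have "bdd_above ((\<lambda>w. l x u w + V (f x u w)) ` W)" by (auto simp: bdd_above_def)
  then show ?thesis unfolding worst_cost_def using zero_in_W by (intro cSUP_le_iff) auto
qed

lemma epigraph_step_iff:
  assumes "bdd_above (V ` S)"
  shows "(x, c) \<in> epigraph_step (epigraph S V) \<longleftrightarrow>
    x \<in> X \<and> (\<exists>u\<in>admissible_inputs f U W S x. worst_cost f l W V x u \<le> c)"
proof (cases "x \<in> X")
  case True
  have "u \<in> U \<and> (\<forall>w\<in>W. (f x u w, c - l x u w) \<in> epigraph S V) \<longleftrightarrow>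
      u \<in> admissible_inputs f U W S x \<and> worst_cost f l W V x u \<le> c" for u
  proof (cases "u \<in> admissible_inputs f U W S x")
    case adm: True
    then show ?thesis unfolding worst_cost_le_iff[OF assms True adm]
      by (auto simp: mem_epigraph admissible_inputs_def algebra_simps)
  qed (auto simp: mem_epigraph admissible_inputs_def)
  then show ?thesis unfolding epigraph_step_def using True by blast
qed (simp add: epigraph_step_def)

lemma worst_cost_nonneg:
  assumes "bdd_above (V ` S)" "\<And>x. x \<in> S \<Longrightarrow> 0 \<le> V x" "x \<in> X" "u \<in> admissible_inputs f U W S x"
  shows "0 \<le> worst_cost f l W V x u"
proof -
  have "l x u 0 + V (f x u 0) \<le> worst_cost f l W V x u"
    using worst_cost_le_iff[OF assms(1,3,4)] zero_in_W by blast
  moreover have "0 \<le> V (f x u 0)"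
    using assms(2,4) zero_in_W by (auto simp: admissible_inputs_def)
  ultimately show ?thesis using stage_nonneg[of x u] by simp
qed

text \<open>The costs that some input guarantees at \<open>x\<close> form a section of the closed set
  \<open>epigraph_step (epigraph S V)\<close>. They are bounded below, so the least one is itself guaranteed.\<close>

lemma minimizer_exists:
  assumes closed: "closed (epigraph S V)" and bdd: "bdd_above (V ` S)"
    and nonneg: "\<And>x. x \<in> S \<Longrightarrow> 0 \<le> V x"
    and "x \<in> X" and u0: "u0 \<in> admissible_inputs f U W S x"
  obtains u where "u \<in> admissible_inputs f U W S x"
    "\<And>v. v \<in> admissible_inputs f U W S x \<Longrightarrow> worst_cost f l W V x u \<le> worst_cost f l W V x v"
proof -
  define T where "T = (\<lambda>c. (x, c)) -` epigraph_step (epigraph S V)"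
  have T_iff: "c \<in> T \<longleftrightarrow> (\<exists>u\<in>admissible_inputs f U W S x. worst_cost f l W V x u \<le> c)" for c
    using \<open>x \<in> X\<close> by (simp add: T_def epigraph_step_iff[OF bdd])
  have "closed T"
    unfolding T_def by (intro closed_vimage closed_epigraph_step closed continuous_intros)
  moreover have "T \<noteq> {}" using u0 T_iff by blast
  moreover have bdd_T: "bdd_below T"
  proof (rule bdd_belowI[of _ 0])
    fix c assume "c \<in> T"
    then obtain u where u: "u \<in> admissible_inputs f U W S x" "worst_cost f l W V x u \<le> c"
      unfolding T_iff by blast
    from worst_cost_nonneg[OF bdd nonneg \<open>x \<in> X\<close> u(1)] u(2) show "0 \<le> c" by simp
  qed
  ultimately have "Inf T \<in> T" by (intro closed_contains_Inf)
  then obtain u where u: "u \<in> admissible_inputs f U W S x" "worst_cost f l W V x u \<le> Inf T"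
    unfolding T_iff by blast
  show thesis
  proof (rule that[OF u(1)])
    fix v assume "v \<in> admissible_inputs f U W S x"
    then have "worst_cost f l W V x v \<in> T" unfolding T_iff by blast
    then have "Inf T \<le> worst_cost f l W V x v" using bdd_T by (rule cInf_lower)
    with u(2) show "worst_cost f l W V x u \<le> worst_cost f l W V x v" by simp
  qed
qed

text \<open>The three properties feed on one another: \<open>cost (Suc j)\<close> equals the worst-case cost of its law only
  because a minimizer exists, which takes closedness, a finite supremum and a lower bound at
  stage \<open>j\<close>. Hence they are proved by one induction.\<close>

definition well_behaved :: "nat \<Rightarrow> bool" where
  "well_behaved j \<longleftrightarrow> closed (epigraph (feas j) (cost j)) \<and> bdd_above (cost j ` feas j) \<and>
     (\<forall>x\<in>feas j. 0 \<le> cost j x)"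

lemma feas_Suc_iff:
  "x \<in> feas (Suc j) \<longleftrightarrow> x \<in> X \<and> (\<exists>u. u \<in> admissible_inputs f U W (feas j) x)"
  by (auto simp: admissible_inputs_def)

lemma law_is_minimizer:
  assumes "well_behaved j" "x \<in> feas (Suc j)"
  shows "law (Suc j) x \<in> admissible_inputs f U W (feas j) x"
    and "cost (Suc j) x = worst_cost f l W (cost j) x (law (Suc j) x)"
    and "v \<in> admissible_inputs f U W (feas j) x \<Longrightarrow> cost (Suc j) x \<le> worst_cost f l W (cost j) x v"
proof -
  let ?adm = "admissible_inputs f U W (feas j) x" and ?J = "worst_cost f l W (cost j) x"
  from assms obtain u where "u \<in> ?adm" "\<And>v. v \<in> ?adm \<Longrightarrow> ?J u \<le> ?J v"
    unfolding well_behaved_def feas_Suc_iff by (metis minimizer_exists)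
  \<comment> \<open>The choice hidden in \<open>opt_law\<close> is arbitrary unless a minimizer exists.\<close>
  then have "is_arg_min ?J (\<lambda>u. u \<in> ?adm) u" by (auto simp: is_arg_min_linorder)
  then have "is_arg_min ?J (\<lambda>u. u \<in> ?adm) (law (Suc j) x)"
    unfolding opt_law_def arg_min_on_def arg_min_def by (simp add: someI)
  then have law: "law (Suc j) x \<in> ?adm" "\<And>v. v \<in> ?adm \<Longrightarrow> ?J (law (Suc j) x) \<le> ?J v"
    by (auto simp: is_arg_min_linorder)
  show "law (Suc j) x \<in> ?adm" by (fact law(1))
  show eq: "cost (Suc j) x = ?J (law (Suc j) x)"
    unfolding opt_cost.simps using law by (intro cInf_eq_minimum) auto
  show "cost (Suc j) x \<le> ?J v" if "v \<in> ?adm" for v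
    unfolding eq using that by (rule law(2))
qed

text \<open>Attainment is what makes this an equality: otherwise the right-hand side could lack the
  boundary points \<open>(x, cost (Suc j) x)\<close>.\<close>

lemma epigraph_cost_Suc:
  assumes "well_behaved j"
  shows "epigraph (feas (Suc j)) (cost (Suc j)) = epigraph_step (epigraph (feas j) (cost j))"
proof -
  have bdd: "bdd_above (cost j ` feas j)" using assms by (simp add: well_behaved_def)
  have "x \<in> feas (Suc j) \<and> cost (Suc j) x \<le> c \<longleftrightarrow>
      x \<in> X \<and> (\<exists>u\<in>admissible_inputs f U W (feas j) x. worst_cost f l W (cost j) x u \<le> c)"
    (is "?L \<longleftrightarrow> ?R") for x c
  proof
    assume ?L
    then show ?R using law_is_minimizer(1,2)[OF assms, of x] feas_Suc_iff[of x j] by auto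
  next
    assume R: ?R
    then obtain u where u: "u \<in> admissible_inputs f U W (feas j) x" "worst_cost f l W (cost j) x u \<le> c"
      by blast
    have x: "x \<in> feas (Suc j)" unfolding feas_Suc_iff using R u(1) by blast
    from law_is_minimizer(3)[OF assms x u(1)] u(2) x show ?L by (auto simp del: feas_set.simps opt_cost.simps)
  qed
  then show ?thesis
    by (auto simp: set_eq_iff mem_epigraph epigraph_step_iff[OF bdd]
        simp del: feas_set.simps opt_cost.simps)
qed

lemma well_behaved: "well_behaved j"
proof (induction j)
  case 0
  show ?case
    using terminal_closed terminal_bounded terminal_nonneg by (simp add: well_behaved_def)
next
  case (Suc j)
  then have closed: "closed (epigraph (feas j) (cost j))" and bdd: "bdd_above (cost j ` feas j)"
    and nonneg: "\<And>x. x \<in> feas j \<Longrightarrow> 0 \<le> cost j x"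
    by (auto simp: well_behaved_def)
  obtain L where L: "\<And>x u w. x \<in> X \<Longrightarrow> u \<in> U \<Longrightarrow> w \<in> W \<Longrightarrow> l x u w \<le> L"
    using stage_bounded by blast
  obtain M where M: "\<And>x. x \<in> feas j \<Longrightarrow> cost j x \<le> M" using bdd by (auto simp: bdd_above_def)
  have bounds: "0 \<le> cost (Suc j) x \<and> cost (Suc j) x \<le> L + M" if x: "x \<in> feas (Suc j)" for x
  proof
    have "x \<in> X" using x by simp
    note adm = law_is_minimizer(1)[OF Suc x]
    show "0 \<le> cost (Suc j) x"
      unfolding law_is_minimizer(2)[OF Suc x]
      by (rule worst_cost_nonneg[OF bdd nonneg \<open>x \<in> X\<close> adm])
    have "l x (law (Suc j) x) w + cost j (f x (law (Suc j) x) w) \<le> L + M" if "w \<in> W" for w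
      using adm \<open>x \<in> X\<close> that by (intro add_mono L M) (auto simp: admissible_inputs_def)
    then show "cost (Suc j) x \<le> L + M"
      unfolding law_is_minimizer(2)[OF Suc x] worst_cost_le_iff[OF bdd \<open>x \<in> X\<close> adm] by blast
  qed
  then have "bdd_above (cost (Suc j) ` feas (Suc j))" by (intro bdd_aboveI2) blast
  moreover have "closed (epigraph (feas (Suc j)) (cost (Suc j)))"
    unfolding epigraph_cost_Suc[OF Suc] by (rule closed_epigraph_step[OF closed])
  ultimately show ?case using bounds unfolding well_behaved_def by blast
qed

lemma cost_nonneg: "x \<in> feas j \<Longrightarrow> 0 \<le> cost j x"
  using well_behaved[of j] by (simp add: well_behaved_def)

lemma cost_bounded: "bdd_above (cost j ` feas j)"
  using well_behaved[of j] by (simp add: well_behaved_def)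

text \<open>The terminal control gives the inclusion of the first two epigraphs; monotonicity of the operator
  propagates it.\<close>

lemma epigraph_cost_mono:
  "epigraph (feas j) (cost j) \<subseteq> epigraph (feas (Suc j)) (cost (Suc j))"
proof (induction j)
  case 0
  have "(x, c) \<in> epigraph_step (epigraph Xf Vf)" if "x \<in> Xf" "Vf x \<le> c" for x c
    using terminal_control[OF that(1)] that terminal_subset
    by (force simp: epigraph_step_def mem_epigraph)
  then show ?case unfolding epigraph_cost_Suc[OF well_behaved] by (auto simp: epigraph_def)
next
  case (Suc j)
  then show ?case
    using epigraph_step_mono epigraph_cost_Suc[OF well_behaved] by metis
qed

lemma feas_mono: "feas j \<subseteq> feas (Suc j)"
  and cost_antimono: "x \<in> feas j \<Longrightarrow> cost (Suc j) x \<le> cost j x"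
  using epigraph_cost_mono[of j] by (auto simp: epigraph_def subset_iff)

lemma terminal_subset_feas: "Xf \<subseteq> feas j"
  and cost_le_terminal: "x \<in> Xf \<Longrightarrow> cost j x \<le> Vf x"
proof -
  have "epigraph Xf Vf \<subseteq> epigraph (feas j) (cost j)"
    by (induction j) (use epigraph_cost_mono in \<open>auto simp del: feas_set.simps(2) opt_cost.simps(2)\<close>)
  then show "Xf \<subseteq> feas j" and "x \<in> Xf \<Longrightarrow> cost j x \<le> Vf x"
    by (auto simp: epigraph_def subset_iff)
qed

lemma bellman_inequality:
  assumes "x \<in> feas (Suc j)" "w \<in> W"
  shows "f x (law (Suc j) x) w \<in> feas j"
    and "l x (law (Suc j) x) w + cost j (f x (law (Suc j) x) w) \<le> cost (Suc j) x"
proof -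
  note adm = law_is_minimizer(1)[OF well_behaved assms(1)]
  then show "f x (law (Suc j) x) w \<in> feas j"
    using assms(2) by (auto simp: admissible_inputs_def)
  have "x \<in> X" using assms(1) by simp
  from worst_cost_le_iff[OF cost_bounded this adm]
  show "l x (law (Suc j) x) w + cost j (f x (law (Suc j) x) w) \<le> cost (Suc j) x"
    using assms(2) law_is_minimizer(2)[OF well_behaved assms(1)] by auto
qed

text \<open>The Bellman inequality relates two horizons; since the successor already lies in the smaller
  feasible set, where the cost can only fall as the horizon grows, one horizon suffices.\<close>

lemma dissipation_inequality:
  assumes "x \<in> feas (Suc j)" "w \<in> W"
  shows "f x (law (Suc j) x) w \<in> feas (Suc j)"
    and "l x (law (Suc j) x) w + cost (Suc j) (f x (law (Suc j) x) w) \<le> cost (Suc j) x"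
proof -
  note next_in = bellman_inequality(1)[OF assms]
  show "f x (law (Suc j) x) w \<in> feas (Suc j)" using feas_mono next_in by blast
  show "l x (law (Suc j) x) w + cost (Suc j) (f x (law (Suc j) x) w) \<le> cost (Suc j) x"
    using bellman_inequality(2)[OF assms] cost_antimono[OF next_in] by linarith
qed

lemma stage_le_cost:
  assumes "x \<in> feas (Suc j)"
  shows "l x (law (Suc j) x) 0 \<le> cost (Suc j) x"
  using dissipation_inequality[OF assms zero_in_W] cost_nonneg[of "f x (law (Suc j) x) 0" "Suc j"]
  by linarith

end


section \<open>The linear quadratic problem\<close>

theorem theorem7:
  fixes A :: "real^'n^'n" and B :: "real^'m^'n" and G :: "real^'p^'n"
    and Q :: "real^'n^'n" and R :: "real^'m^'m" and C :: "real^'n^'q"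
    and H :: "real^('n + 'm)^'r" and \<gamma> :: real
    and Pf :: "real^'n^'n" and Ku :: "real^'n^'m" and Kw :: "real^'n^'p"
    and X Xf :: "(real^'n) set" and U :: "(real^'m) set" and W :: "(real^'p) set"
    and f :: "real^'n \<Rightarrow> real^'m \<Rightarrow> real^'p \<Rightarrow> real^'n"
    and l :: "real^'n \<Rightarrow> real^'m \<Rightarrow> real^'p \<Rightarrow> real"
    and h :: "real^'n \<Rightarrow> real^'m \<Rightarrow> real^'r"
    and Vf :: "real^'n \<Rightarrow> real" and N :: nat
  assumes f_eq: "f = (\<lambda>x u w. A *v x + B *v u + G *v w)"
    and l_eq: "l = (\<lambda>x u w. 1 / 2 * (x \<bullet> (Q *v x)) + 1 / 2 * (u \<bullet> (R *v u))
                        - \<gamma>\<^sup>2 / 2 * (norm w)\<^sup>2)"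
    and h_eq: "h = (\<lambda>x u. H *v stack x u)"
    and Vf_eq: "Vf = (\<lambda>x. 1 / 2 * (x \<bullet> (Pf *v x)))"
    and H: "\<And>x u. (norm (h x u))\<^sup>2 = x \<bullet> (Q *v x) + u \<bullet> (R *v u)"
    and Q: "pos_def Q" and R: "pos_def R"
    and X: "polytope X" "0 \<in> interior X"
    and U: "polytope U" "0 \<in> interior U"
    and W: "polytope W" "0 \<in> interior W"
    and stab: "stabilizable A B"
    and QC: "Q = transpose C ** C"
    and zeros: "\<And>z. cmod z = 1 \<Longrightarrow> \<not> invariant_zero C A B z"
    and Pf: "pos_def Pf" "hinf_riccati A B G Q R \<gamma> Pf"
    and gains: "hinf_gains A B G R \<gamma> Pf Ku Kw"
    and value_Vf: "\<And>x. min_max_attained (\<lambda>u w. l x u w + Vf (f x u w)) (Ku *v x) (Kw *v x) (Vf x)"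
    and stable: "schur_stable (A + B ** Ku)" "schur_stable (A + B ** Ku + G ** Kw)"
    and Xf: "polytope Xf" "0 \<in> interior Xf"
    and Xf_inv: "\<And>x. x \<in> Xf \<Longrightarrow> f x (Ku *v x) ` W \<subseteq> Xf"
    and Xf_adm: "Xf \<subseteq> X" "(*v) Ku ` Xf \<subseteq> U" "(*v) Kw ` Xf \<subseteq> W"
    and N: "1 \<le> N"
  shows "finite_l2_gain f (opt_law f l X U W Vf Xf N) h W \<gamma>
           (opt_cost f l X U W Vf Xf N) (interior (feas_set f X U W Xf N))
       \<and> exp_stable_region (\<lambda>x. f x (opt_law f l X U W Vf Xf N x) 0) (feas_set f X U W Xf N)"
proof -
  have form_nonneg: "0 \<le> x \<bullet> (M *v x)" if "pos_def M" for M :: "real^'k^'k" and x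
    using that by (cases "x = 0") (auto simp: pos_def_def less_imp_le)
  have compact: "compact X" "compact U" "compact Xf"
    using X(1) U(1) Xf(1) by (auto intro: polytope_imp_compact)
  have zero_W: "0 \<in> W" using W(2) interior_subset by blast

  have cont_Vf: "continuous_on Xf Vf"
    unfolding Vf_eq by (intro continuous_intros continuous_on_quadratic_form)

  interpret minmax_problem f l X U W Vf Xf
  proof
    fix w
    show "continuous_on UNIV (\<lambda>(x, u). f x u w)"
      unfolding f_eq case_prod_unfold
      by (intro continuous_intros
          continuous_on_compose2[OF matrix_vector_mult_linear_continuous_on[of UNIV]]) auto
    show "continuous_on UNIV (\<lambda>(x, u). l x u w)"
      unfolding l_eq case_prod_unfold
      by (intro continuous_intros continuous_on_compose2[OF continuous_on_quadratic_form[of UNIV]]) auto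
  next
    obtain bX where bX: "\<And>x. x \<in> X \<Longrightarrow> x \<bullet> (Q *v x) \<le> bX"
      using bounded_imp_bdd_above[OF compact_imp_bounded,
          OF compact_continuous_image[OF continuous_on_quadratic_form compact(1)], of Q]
      by (auto simp: bdd_above_def)
    obtain bU where bU: "\<And>u. u \<in> U \<Longrightarrow> u \<bullet> (R *v u) \<le> bU"
      using bounded_imp_bdd_above[OF compact_imp_bounded,
          OF compact_continuous_image[OF continuous_on_quadratic_form compact(2)], of R]
      by (auto simp: bdd_above_def)
    have "l x u w \<le> 1 / 2 * bX + 1 / 2 * bU" if "x \<in> X" "u \<in> U" for x u w
    proof -
      have "0 \<le> \<gamma>\<^sup>2 / 2 * (norm w)\<^sup>2" by simp
      then show ?thesis using bX[OF that(1)] bU[OF that(2)] unfolding l_eq by linarith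
    qed
    then show "\<exists>L. \<forall>x\<in>X. \<forall>u\<in>U. \<forall>w\<in>W. l x u w \<le> L" by blast
  next
    show "0 \<le> l x u 0" for x u
      using form_nonneg[OF Q] form_nonneg[OF R] by (simp add: l_eq)
    show "closed X" "compact U" "0 \<in> W" "Xf \<subseteq> X"
      using compact zero_W Xf_adm(1) by (auto intro: compact_imp_closed)
    show "closed (epigraph Xf Vf)"
    proof -
      have "closed ((Xf \<times> UNIV) \<inter> {p. Vf (fst p) \<le> snd p})"
        unfolding Vf_eq
        by (intro closed_Int closed_Times compact_imp_closed compact closed_UNIV closed_Collect_le
            continuous_intros continuous_on_compose2[OF continuous_on_quadratic_form[of UNIV]]) auto
      moreover have "(Xf \<times> UNIV) \<inter> {p. Vf (fst p) \<le> snd p} = epigraph Xf Vf"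
        by (auto simp: epigraph_def)
      ultimately show ?thesis by simp
    qed
    show "bdd_above (Vf ` Xf)"
      using compact_continuous_image[OF cont_Vf compact(3)]
      by (intro bounded_imp_bdd_above compact_imp_bounded)
    show "0 \<le> Vf x" for x
      using form_nonneg[OF Pf(1)] by (simp add: Vf_eq)
    show "\<exists>u\<in>U. \<forall>w\<in>W. f x u w \<in> Xf \<and> l x u w + Vf (f x u w) \<le> Vf x" if "x \<in> Xf" for x
      using that Xf_inv[OF that] Xf_adm(2) value_Vf[of x]
      by (intro bexI[of _ "Ku *v x"]) (auto simp: min_max_attained_def)
  qed

  obtain j where N_Suc: "N = Suc j" using N by (cases N) auto
  let ?\<kappa> = "law N" and ?V = "cost N" and ?S = "feas N"
  have nonneg: "\<And>x. x \<in> ?S \<Longrightarrow> 0 \<le> ?V x" by (rule cost_nonneg)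
  have invar: "\<And>x w. x \<in> ?S \<Longrightarrow> w \<in> W \<Longrightarrow> f x (?\<kappa> x) w \<in> ?S"
    and dissip: "\<And>x w. x \<in> ?S \<Longrightarrow> w \<in> W \<Longrightarrow> l x (?\<kappa> x) w + ?V (f x (?\<kappa> x) w) \<le> ?V x"
    unfolding N_Suc by (rule dissipation_inequality; assumption)+

  have stage: "l x u w = 1 / 2 * (norm (h x u))\<^sup>2 - \<gamma>\<^sup>2 / 2 * (norm w)\<^sup>2" for x u w
    unfolding H by (simp add: l_eq)
  have "finite_l2_gain f ?\<kappa> h W \<gamma> ?V ?S"
  proof (rule finite_l2_gain_if_dissipative)
    show "0 \<le> ?V x" if "x \<in> ?S" for x
      using that by (rule nonneg)
    show "f x (?\<kappa> x) w \<in> ?S" if "x \<in> ?S" "w \<in> W" for x w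
      using that by (rule invar)
    show "?V (f x (?\<kappa> x) w) + 1 / 2 * (norm (h x (?\<kappa> x)))\<^sup>2 \<le> ?V x + \<gamma>\<^sup>2 / 2 * (norm w)\<^sup>2"
      if "x \<in> ?S" "w \<in> W" for x w
      using dissip[OF that] unfolding stage by linarith
  qed
  then have gain: "finite_l2_gain f ?\<kappa> h W \<gamma> ?V (interior ?S)"
    unfolding finite_l2_gain_def using interior_subset by blast

  obtain a where a: "0 < a" "\<And>x. a * (norm x)\<^sup>2 \<le> x \<bullet> (Q *v x)"
    using pos_def_quadratic_lower_bound[OF Q] by blast
  have stage_lower: "a / 2 * (norm x)\<^sup>2 \<le> l x u 0" for x u
    using a(2)[of x] form_nonneg[OF R, of u] by (simp add: l_eq)
  obtain b where b: "\<And>x. x \<bullet> (Pf *v x) \<le> b * (norm x)\<^sup>2"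
    using quadratic_form_upper_bound by blast
  have "?V x \<le> b / 2 * (norm x)\<^sup>2" if "x \<in> Xf" for x
    using cost_le_terminal[OF that, of N] b[of x] by (simp add: Vf_eq)
  then obtain b' where b': "\<And>x. x \<in> ?S \<Longrightarrow> ?V x \<le> b' * (norm x)\<^sup>2"
    using quadratic_upper_bound_extend[OF Xf(2) _ cost_bounded] by blast
  have "exp_stable_region (\<lambda>x. f x (?\<kappa> x) 0) ?S"
  proof (rule exp_stable_region_if_quadratic_lyapunov[where a = "a / 2"])
    show "0 \<in> interior ?S" using interior_mono[OF terminal_subset_feas] Xf(2) by blast
    show "(\<lambda>x. f x (?\<kappa> x) 0) ` ?S \<subseteq> ?S" using invar zero_W by blast
    show "0 < a / 2" using a(1) by simp
    show "a / 2 * (norm x)\<^sup>2 \<le> ?V x" if "x \<in> ?S" for x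
      using stage_lower[of x "?\<kappa> x"] stage_le_cost[of x j] that unfolding N_Suc by linarith
    show "?V x \<le> b' * (norm x)\<^sup>2" if "x \<in> ?S" for x
      using that by (rule b')
    show "?V (f x (?\<kappa> x) 0) \<le> ?V x - a / 2 * (norm x)\<^sup>2" if "x \<in> ?S" for x
      using dissip[OF that zero_W] stage_lower[of x "?\<kappa> x"] by linarith
  qed
  with gain show ?thesis by blast
qed

end
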